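(* Let $\varphi\in(0,\pi]$, $c,d\geq0$ and $\alpha=e^{i\varphi}$. If $\cos\varphi=-1$, or $\cos\varphi$ does not belong to the set of dyadic rationals $\{a/2^b:a,b\in\mathbb{Z},\,b\ge0\}$, then the Lévy measure $c\delta_\alpha+d\delta_{\bar\alpha}$ is L-unique.
   Context: A Lévy measure on $\mathbb{T}$ is a positive Borel measure $\rho$ with $\rho(\{1\})=0$ and $1-\Re s\in L^1(\rho)$. For a Lévy measure $\rho$, $\nu_\circledast^{(1,0,\rho)}$ is the probability measure on $\mathbb{T}$ with $\int s^n\,d\nu=\exp\big(\int_{\mathbb{T}}(s^n-1-in\Im s)\,d\rho(s)\big)$ for $n\in\mathbb{Z}$. $\mathcal{L}(\rho)$ is the set of Lévy measures $\widetilde\rho$ with $\nu_\circledast^{(1,0,\widetilde\rho)}=\nu_\circledast^{(1,0,\rho)}$, and $\rho$ is called L-unique if $\mathcal{L}(\rho)=\{\rho\}$. *)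

theory Defs
  imports "HOL-Probability.Probability"
begin

definition circle_borel :: "complex measure" where
  "circle_borel = restrict_space borel (sphere 0 1)"

definition levy_measure :: "complex measure \<Rightarrow> bool" where
  "levy_measure \<rho> \<longleftrightarrow> sets \<rho> = sets circle_borel \<and> emeasure \<rho> {1} = 0
      \<and> integrable \<rho> (\<lambda>s. 1 - Re s)"

text \<open>The probability measure nu with parameters (1,0,rho): the unique probability
  measure on T whose n-th moments are exp(integral of s^n - 1 - i n Im s).\<close>
definition nu_circ :: "complex measure \<Rightarrow> complex measure" where
  "nu_circ \<rho> = (THE \<nu>. prob_space \<nu> \<and> sets \<nu> = sets circle_borel \<and>
      (\<forall>n::int. (\<integral>s. s powi n \<partial>\<nu>) =
         exp (\<integral>s. s powi n - 1 - \<i> * of_int n * complex_of_real (Im s) \<partial>\<rho>)))"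

definition levy_class :: "complex measure \<Rightarrow> complex measure set" where
  "levy_class \<rho> = {\<rho>'. levy_measure \<rho>' \<and> nu_circ \<rho>' = nu_circ \<rho>}"

definition L_unique :: "complex measure \<Rightarrow> bool" where
  "L_unique \<rho> \<longleftrightarrow> levy_class \<rho> = {\<rho>}"

definition two_point_measure :: "real \<Rightarrow> complex \<Rightarrow> real \<Rightarrow> complex \<Rightarrow> complex measure" where
  "two_point_measure c a d b = measure_of (space circle_borel) (sets circle_borel)
      (\<lambda>A. ennreal c * indicator A a + ennreal d * indicator A b)"

definition dyadic_rationals :: "real set" where
  "dyadic_rationals = {of_int a / 2 ^ nat b | a b :: int. b \<ge> 0}"

end

theory Submission
  imports Defs
begin

text \<open>The kernel \<open>s\<^sup>n - 1 - \<i> n Im s\<close> makes the exponential of the exponent \<open>\<Psi>\<close> positive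
  definite in \<open>n\<close>, so by Herglotz the defining measure of \<open>nu_circ\<close> exists for every Levy measure;
  it is unique by Stone--Weierstrass. Hence two Levy measures in the same class have exponents that
  agree modulo \<open>2 \<pi> \<i>\<close>. Equality of the real parts for \<open>n = 1, 2, 3\<close> already forces the mass onto
  \<open>{\<alpha>, cnj \<alpha>}\<close> with the same total. The imaginary parts then say that, for some real \<open>w\<close>,
  \<open>w (sin (n \<phi>) - n sin \<phi>)\<close> is an integer for all \<open>n\<close>; if \<open>w \<noteq> 0\<close> and \<open>sin \<phi> \<noteq> 0\<close>, this
  makes \<open>2 cos \<phi>\<close> an integer, so that \<open>cos \<phi>\<close> is dyadic.\<close>

section \<open>Kernel and exponent\<close>

text \<open>Subtracting \<open>\<i> * n * Im s\<close> cancels the first-order term of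
  \<open>s powi n - 1\<close> at \<open>s = 1\<close>, so that what remains is integrable against a
  measure that only has to integrate \<open>1 - Re s\<close>.\<close>

definition levy_kernel :: "int \<Rightarrow> complex \<Rightarrow> complex" where
  "levy_kernel n s = s powi n - 1 - \<i> * of_int n * complex_of_real (Im s)"

definition levy_exponent :: "complex measure \<Rightarrow> int \<Rightarrow> complex" where
  "levy_exponent \<rho> n = (\<integral>s. levy_kernel n s \<partial>\<rho>)"

lemma space_circle_borel [simp]: "space circle_borel = sphere 0 1"
  by (simp add: circle_borel_def space_restrict_space)

lemma sets_circle_borel_iff: "A \<in> sets circle_borel \<longleftrightarrow> A \<subseteq> sphere 0 1 \<and> A \<in> sets borel"
  unfolding circle_borel_def
  by (subst sets_restrict_space_iff) auto

lemma borel_measurable_circle: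
  assumes "sets M = sets circle_borel" "f \<in> borel_measurable borel"
  shows "f \<in> borel_measurable M"
proof -
  have "f \<in> borel_measurable circle_borel"
    unfolding circle_borel_def by (intro measurable_restrict_space1 assms)
  then show ?thesis
    using assms(1) measurable_cong_sets by blast
qed

lemma space_circle:
  assumes "sets M = sets circle_borel"
  shows "space M = sphere 0 1"
  using sets_eq_imp_space_eq[OF assms] by simp

lemma power_int_borel_measurable [measurable]: "(\<lambda>s::complex. s powi n) \<in> borel_measurable borel"
  unfolding power_int_def by measurable

lemma levy_kernel_borel_measurable [measurable]: "levy_kernel n \<in> borel_measurable borel"
  unfolding levy_kernel_def by measurable

lemma circle_cases:
  fixes s :: complex
  assumes "norm s = 1"
  obtains t where "- pi < t" "t \<le> pi" "s = cis t"
  using assms Arg_bounded[of s] cis_Arg[of s] by (metis norm_zero sgn_div_norm div_by_1 inverse_1 scaleR_one zero_neq_one)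

lemma levy_kernel_cis:
  "levy_kernel n (cis t) = Complex (cos (n * t) - 1) (sin (n * t) - n * sin t)"
  by (simp add: levy_kernel_def cis_power_int complex_eq_iff)

text \<open>Turns second-order bounds in the distance to \<open>1\<close> into multiples of
  \<open>1 - Re s\<close>, the weight that a Levy measure integrates.\<close>

lemma norm_circle_diff_1:
  fixes s :: complex
  assumes "norm s = 1"
  shows "(norm (s - 1))\<^sup>2 = 2 * (1 - Re s)"
proof -
  have "(Re s)\<^sup>2 + (Im s)\<^sup>2 = 1"
    using assms by (simp add: cmod_def)
  then show ?thesis
    unfolding cmod_power2 by (simp add: power2_eq_square algebra_simps)
qed

lemma norm_circle_power_diff_1:
  fixes s :: complex
  assumes "norm s = 1"
  shows "norm (s ^ n - 1) \<le> n * norm (s - 1)"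
proof -
  have "norm (s ^ n - 1) = norm (s - 1) * norm (\<Sum>k<n. s ^ k)"
    by (simp add: power_diff_1_eq norm_mult)
  also have "norm (\<Sum>k<n. s ^ k) \<le> (\<Sum>k<n. 1)"
    using assms by (intro sum_norm_le) (simp add: norm_power)
  finally show ?thesis
    by (simp add: mult_left_mono mult.commute[of _ "norm (s - 1)"])
qed

lemma levy_kernel_uminus:
  assumes "norm s = 1"
  shows "levy_kernel (- n) s = cnj (levy_kernel n s)"
proof -
  obtain t where s: "s = cis t"
    using circle_cases[OF assms] by blast
  show ?thesis
    unfolding s levy_kernel_cis by (simp add: complex_eq_iff)
qed

text \<open>The factorisation \<open>s\<^sup>n - 1 - n (s - 1) = (s - 1) (\<Sum>k<n. s\<^sup>k - 1)\<close>
  exhibits a second-order zero at \<open>1\<close>, and \<open>1 - Re s\<close> is itself of second order there.\<close>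

lemma norm_levy_kernel_nat_le:
  assumes "norm s = 1"
  shows "norm (levy_kernel (int n) s) \<le> (2 * n\<^sup>2 + n) * (1 - Re s)"
proof -
  have Re: "Re s \<le> 1"
    using assms complex_Re_le_cmod[of s] by simp
  \<comment> \<open>Since \<open>n (s - 1) = \<i> n Im s - n (1 - Re s)\<close>, passing to the
    compensator \<open>n (s - 1)\<close> costs only a multiple of \<open>1 - Re s\<close>. This
    gives the summand \<open>n\<close> of the bound; the product gives
    \<open>2 * n\<^sup>2\<close>.\<close>
  have eq: "levy_kernel (int n) s = (s - 1) * (\<Sum>k<n. s ^ k - 1) - of_real (n * (1 - Re s))"
  proof -
    have "(s - 1) * (\<Sum>k<n. s ^ k - 1) = (s - 1) * (\<Sum>k<n. s ^ k) - n * (s - 1)"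
      by (simp add: sum_subtractf algebra_simps)
    also have "\<dots> = s ^ n - 1 - n * (s - 1)"
      by (simp add: power_diff_1_eq)
    finally have *: "(s - 1) * (\<Sum>k<n. s ^ k - 1) = s ^ n - 1 - n * (s - 1)" .
    show ?thesis
      unfolding * by (simp add: levy_kernel_def complex_eq_iff algebra_simps)
  qed
  have "norm (\<Sum>k<n. s ^ k - 1) \<le> (\<Sum>k<n. n * norm (s - 1))"
  proof (rule sum_norm_le)
    fix k assume "k \<in> {..<n}"
    then have "real k * norm (s - 1) \<le> real n * norm (s - 1)"
      by (intro mult_right_mono) auto
    then show "norm (s ^ k - 1) \<le> n * norm (s - 1)"
      using norm_circle_power_diff_1[OF assms, of k] by linarith
  qed
  then have "norm ((s - 1) * (\<Sum>k<n. s ^ k - 1)) \<le> norm (s - 1) * (n * (n * norm (s - 1)))"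
    by (simp add: norm_mult mult_left_mono)
  also have "\<dots> = n\<^sup>2 * (norm (s - 1))\<^sup>2"
    by (simp add: power2_eq_square)
  also have "\<dots> = 2 * n\<^sup>2 * (1 - Re s)"
    using norm_circle_diff_1[OF assms] by simp
  finally have "norm ((s - 1) * (\<Sum>k<n. s ^ k - 1)) \<le> 2 * n\<^sup>2 * (1 - Re s)" .
  moreover have "norm (complex_of_real (n * (1 - Re s))) = n * (1 - Re s)"
    using Re by (simp only: norm_of_real) simp
  ultimately show ?thesis
    unfolding eq using norm_triangle_ineq4[of "(s - 1) * (\<Sum>k<n. s ^ k - 1)" "of_real (n * (1 - Re s))"]
    by (simp add: algebra_simps)
qed

lemma norm_levy_kernel_le:
  assumes "norm s = 1"
  shows "norm (levy_kernel n s) \<le> (2 * (nat \<bar>n\<bar>)\<^sup>2 + nat \<bar>n\<bar>) * (1 - Re s)"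
proof (cases "n \<ge> 0")
  case True
  then show ?thesis
    using norm_levy_kernel_nat_le[OF assms, of "nat n"] by simp
next
  case False
  then show ?thesis
    using norm_levy_kernel_nat_le[OF assms, of "nat (- n)"] levy_kernel_uminus[OF assms, of n]
    by simp
qed

lemma integrable_levy_kernel:
  assumes "levy_measure \<rho>"
  shows "integrable \<rho> (levy_kernel n)"
proof (rule Bochner_Integration.integrable_bound)
  show "integrable \<rho> (\<lambda>s. (2 * (nat \<bar>n\<bar>)\<^sup>2 + nat \<bar>n\<bar>) * (1 - Re s))"
    using assms by (intro integrable_mult_right) (simp add: levy_measure_def)
  show "levy_kernel n \<in> borel_measurable \<rho>"
    by (rule borel_measurable_circle) (use assms in \<open>simp_all add: levy_measure_def levy_kernel_borel_measurable\<close>)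
  show "AE s in \<rho>. norm (levy_kernel n s) \<le> norm ((2 * (nat \<bar>n\<bar>)\<^sup>2 + nat \<bar>n\<bar>) * (1 - Re s))"
  proof (rule AE_I2)
    fix s assume "s \<in> space \<rho>"
    then have "norm s = 1"
      using assms space_circle[of \<rho>] by (auto simp: levy_measure_def)
    from order_trans[OF norm_levy_kernel_le[OF this, of n] abs_ge_self]
    show "norm (levy_kernel n s) \<le> norm ((2 * (nat \<bar>n\<bar>)\<^sup>2 + nat \<bar>n\<bar>) * (1 - Re s))"
      by (simp only: real_norm_def)
  qed
qed

section \<open>Measures on the circle are determined by their moments\<close>

text \<open>On the circle \<open>cnj s = 1 / s\<close>, so \<open>Re s\<close> and
  \<open>Im s\<close> are Laurent polynomials in \<open>s\<close>, and so is every real polynomial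
  in them; the factor \<open>s ^ N\<close> clears the negative powers.\<close>

lemma circle_real_polynomial:
  assumes "real_polynomial_function (f :: complex \<Rightarrow> real)"
  shows "\<exists>N p. \<forall>s. norm s = 1 \<longrightarrow> complex_of_real (f s) * s ^ N = poly p s"
  using assms
proof induction
  case (linear f)
  have f: "f s = Re s * f 1 + Im s * f \<i>" for s
  proof -
    have "s = Re s *\<^sub>R 1 + Im s *\<^sub>R \<i>"
      by (simp add: complex_eq_iff)
    then have "f s = f (Re s *\<^sub>R 1 + Im s *\<^sub>R \<i>)"
      by (rule arg_cong)
    also have "\<dots> = Re s * f 1 + Im s * f \<i>"
      using bounded_linear.linear[OF linear] by (simp only: linear_add linear_scale real_scaleR_def)
    finally show ?thesis .
  qed
  \<comment> \<open>The coefficients come from \<open>Re s = (s + 1/s) / 2\<close> and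
    \<open>Im s = (s - 1/s) / (2 \<i>)\<close>, multiplied by \<open>s\<close>.\<close>
  have "complex_of_real (f s) * s ^ 1 =
      poly [:of_real (f 1) / 2 + \<i> * of_real (f \<i>) / 2, 0, of_real (f 1) / 2 - \<i> * of_real (f \<i>) / 2:] s"
    if "norm s = 1" for s
  proof -
    have "(Re s)\<^sup>2 + (Im s)\<^sup>2 = 1"
      using that by (simp add: cmod_def)
    then have R: "Re s * Re s = 1 - Im s * Im s"
      by (simp add: power2_eq_square)
    define A B where "A = f 1" and "B = f \<i>"
    have "f s = Re s * A + Im s * B"
      unfolding A_def B_def by (rule f)
    then show ?thesis
      unfolding A_def[symmetric] B_def[symmetric]
      by (simp add: complex_eq_iff algebra_simps R add_divide_distrib diff_divide_distrib)
  qed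
  then show ?case by blast
next
  case (const c)
  have "complex_of_real c * s ^ 0 = poly [:of_real c:] s" for s by simp
  then show ?case by blast
next
  case (add f g)
  then obtain N p M q where
    "\<forall>s. norm s = 1 \<longrightarrow> complex_of_real (f s) * s ^ N = poly p s"
    "\<forall>s. norm s = 1 \<longrightarrow> complex_of_real (g s) * s ^ M = poly q s" by blast
  then have pq: "poly p s = complex_of_real (f s) * s ^ N" "poly q s = complex_of_real (g s) * s ^ M"
    if "norm s = 1" for s using that by simp_all
  have "\<forall>s. norm s = 1 \<longrightarrow>
      complex_of_real (f s + g s) * s ^ (N + M) = poly (p * monom 1 M + q * monom 1 N) s"
    by (simp add: pq poly_monom power_add algebra_simps)
  then show ?case by blast
next
  case (mult f g)
  then obtain N p M q where
    "\<forall>s. norm s = 1 \<longrightarrow> complex_of_real (f s) * s ^ N = poly p s"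
    "\<forall>s. norm s = 1 \<longrightarrow> complex_of_real (g s) * s ^ M = poly q s" by blast
  then have pq: "poly p s = complex_of_real (f s) * s ^ N" "poly q s = complex_of_real (g s) * s ^ M"
    if "norm s = 1" for s using that by simp_all
  have "\<forall>s. norm s = 1 \<longrightarrow>
      complex_of_real (f s * g s) * s ^ (N + M) = poly (p * q) s"
    by (simp add: pq poly_monom power_add algebra_simps)
  then show ?case by blast
qed

lemma integrable_circle_continuous:
  fixes f :: "complex \<Rightarrow> 'b::{banach, second_countable_topology}"
  assumes "finite_measure M" "sets M = sets circle_borel" "continuous_on (sphere 0 1) f"
  shows "integrable M f"
proof -
  interpret finite_measure M by fact
  have "bounded (f ` sphere 0 1)"
    by (intro compact_imp_bounded compact_continuous_image assms) auto
  then obtain B where B: "\<And>s. s \<in> sphere 0 1 \<Longrightarrow> norm (f s) \<le> B"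
    unfolding bounded_iff by blast
  show ?thesis
  proof (rule integrable_const_bound)
    show "AE x in M. norm (f x) \<le> B"
      using B space_circle[OF assms(2)] by (intro AE_I2) auto
    have "f \<in> borel_measurable circle_borel"
      unfolding circle_borel_def by (intro borel_measurable_continuous_on_restrict assms)
    then show "f \<in> borel_measurable M"
      using assms(2) measurable_cong_sets by blast
  qed
qed

text \<open>A polynomial on the circle is a finite combination of integer powers of
  \<open>s\<close>, so its integral is the same combination of moments.\<close>

lemma circle_integral_polynomial_eq:
  assumes fin: "finite_measure M" "finite_measure N"
    and sets: "sets M = sets circle_borel" "sets N = sets circle_borel"
    and eq: "\<And>n. (\<integral>s. s powi n \<partial>M) = (\<integral>s. s powi n \<partial>N)"
    and f: "real_polynomial_function (f :: complex \<Rightarrow> real)"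
  shows "(\<integral>s. f s \<partial>M) = (\<integral>s. f s \<partial>N)"
proof -
  obtain K p where p: "\<And>s. norm s = 1 \<Longrightarrow> complex_of_real (f s) * s ^ K = poly p s"
    using circle_real_polynomial[OF f] by blast
  have f_eq: "complex_of_real (f s) = (\<Sum>i\<le>degree p. coeff p i * s powi (int i - int K))"
    if "norm s = 1" for s
  proof -
    have [simp]: "s \<noteq> 0" using that by auto
    have "complex_of_real (f s) = poly p s / s ^ K"
      using p[OF that] by (simp add: field_simps)
    then show ?thesis
      by (simp add: poly_altdef sum_divide_distrib power_int_diff)
  qed
  have cont: "continuous_on (sphere 0 1) (\<lambda>s :: complex. s powi n)" for n :: int
    unfolding power_int_def by (cases "n \<ge> 0") (auto intro!: continuous_intros)
  have *: "complex_of_real (\<integral>s. f s \<partial>Q) = (\<Sum>i\<le>degree p. coeff p i * (\<integral>s. s powi (int i - int K) \<partial>Q))"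
    if "finite_measure Q" "sets Q = sets circle_borel" for Q
  proof -
    have "complex_of_real (\<integral>s. f s \<partial>Q) = (\<integral>s. complex_of_real (f s) \<partial>Q)"
      by simp
    also have "\<dots> = (\<integral>s. (\<Sum>i\<le>degree p. coeff p i * s powi (int i - int K)) \<partial>Q)"
      using space_circle[OF that(2)] f_eq by (intro Bochner_Integration.integral_cong) auto
    also have "\<dots> = (\<Sum>i\<le>degree p. (\<integral>s. coeff p i * s powi (int i - int K) \<partial>Q))"
      by (intro Bochner_Integration.integral_sum integrable_mult_right integrable_circle_continuous that cont)
    finally show ?thesis by simp
  qed
  have "complex_of_real (\<integral>s. f s \<partial>M) = complex_of_real (\<integral>s. f s \<partial>N)"
    by (simp only: *[OF fin(1) sets(1)] *[OF fin(2) sets(2)] eq)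
  then show ?thesis by simp
qed

text \<open>Uniform approximation by polynomials; the total mass being one, a uniform error bound is
  also a bound for the error of the integral.\<close>

lemma circle_integral_continuous_eq:
  assumes prob: "prob_space M" "prob_space N"
    and sets: "sets M = sets circle_borel" "sets N = sets circle_borel"
    and eq: "\<And>n. (\<integral>s. s powi n \<partial>M) = (\<integral>s. s powi n \<partial>N)"
    and f: "continuous_on (sphere 0 1) (f :: complex \<Rightarrow> real)"
  shows "(\<integral>s. f s \<partial>M) = (\<integral>s. f s \<partial>N)"
proof (rule ccontr)
  assume ne: "(\<integral>s. f s \<partial>M) \<noteq> (\<integral>s. f s \<partial>N)"
  \<comment> \<open>With a third of the supposed gap, the two approximation errors add up to at most
    two thirds of it, which is absurd.\<close>
  define e where "e = \<bar>(\<integral>s. f s \<partial>M) - (\<integral>s. f s \<partial>N)\<bar> / 3"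
  have "e > 0" using ne by (simp add: e_def)
  interpret M: prob_space M by fact
  interpret N: prob_space N by fact
  obtain g where g: "real_polynomial_function g" "\<And>x. x \<in> sphere 0 1 \<Longrightarrow> \<bar>f x - g x\<bar> < e"
    using Stone_Weierstrass_real_polynomial_function[OF compact_sphere f \<open>e > 0\<close>] by blast
  have cont: "continuous_on (sphere 0 1) g"
    using g(1) continuous_on_polymonial_function real_polynomial_function_eq by blast
  have *: "\<bar>(\<integral>s. f s \<partial>Q) - (\<integral>s. g s \<partial>Q)\<bar> \<le> e"
    if "prob_space Q" "sets Q = sets circle_borel" for Q
  proof -
    interpret Q: prob_space Q by fact
    have int: "integrable Q f" "integrable Q g"
      by (intro integrable_circle_continuous that f cont Q.finite_measure_axioms)+
    have "\<bar>(\<integral>s. f s \<partial>Q) - (\<integral>s. g s \<partial>Q)\<bar> = \<bar>\<integral>s. f s - g s \<partial>Q\<bar>"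
      using int by simp
    also have "\<dots> \<le> (\<integral>s. \<bar>f s - g s\<bar> \<partial>Q)"
      by (rule integral_abs_bound)
    also have "\<dots> \<le> (\<integral>s. e \<partial>Q)"
      using int g(2) space_circle[OF that(2)] by (intro integral_mono) (auto intro: less_imp_le)
    finally show ?thesis by (simp add: Q.prob_space)
  qed
  have "(\<integral>s. g s \<partial>M) = (\<integral>s. g s \<partial>N)"
    by (intro circle_integral_polynomial_eq M.finite_measure_axioms N.finite_measure_axioms sets eq g)
  then have "\<bar>(\<integral>s. f s \<partial>M) - (\<integral>s. f s \<partial>N)\<bar> \<le> 2 * e"
    using *[OF prob(1) sets(1)] *[OF prob(2) sets(2)] by linarith
  then show False
    using ne unfolding e_def by simp
qed

text \<open>Indicators of closed sets are pointwise limits of continuous functions bounded by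
  \<open>1\<close>, so equal integrals of continuous functions give equal measure to closed sets,
  which form an intersection-stable generator.\<close>

lemma circle_moments_unique:
  assumes prob: "prob_space M" "prob_space N"
    and sets: "sets M = sets circle_borel" "sets N = sets circle_borel"
    and eq: "\<And>n. (\<integral>s. s powi n \<partial>M) = (\<integral>s. s powi n \<partial>N)"
  shows "M = N"
proof -
  interpret M: prob_space M by fact
  interpret N: prob_space N by fact
  have id: "(\<lambda>s. s) \<in> borel_measurable M" "(\<lambda>s. s) \<in> borel_measurable N"
    by (rule borel_measurable_circle, simp_all add: sets)+
  have lim: "(\<lambda>k. \<integral>s. max 0 (1 - real k * infdist s C) \<partial>Q) \<longlonglongrightarrow> (\<integral>s. indicator C s \<partial>Q)"
    if "finite_measure Q" "sets Q = sets circle_borel" "closed C" "C \<noteq> {}" for Q and C :: "complex set"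
  proof -
    interpret finite_measure Q by fact
    show ?thesis
    proof (rule integral_dominated_convergence[where w = "\<lambda>_. 1"])
      show "(\<lambda>s. indicator C s :: real) \<in> borel_measurable Q"
        by (rule borel_measurable_circle) (use that in auto)
      show "(\<lambda>s. max 0 (1 - real k * infdist s C)) \<in> borel_measurable Q" for k
        by (rule borel_measurable_circle)
          (use that in \<open>auto intro!: borel_measurable_continuous_onI continuous_intros\<close>)
      show "AE s in Q. (\<lambda>k. max 0 (1 - real k * infdist s C)) \<longlonglongrightarrow> indicator C s"
      proof (rule AE_I2)
        fix s
        show "(\<lambda>k. max 0 (1 - real k * infdist s C)) \<longlonglongrightarrow> indicator C s"
        proof (cases "s \<in> C")
          case False
          then have pos: "infdist s C > 0"
            using in_closed_iff_infdist_zero[OF that(3,4)] infdist_nonneg[of s C] by fastforce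
          obtain k0 :: nat where k0: "1 / infdist s C < k0"
            using reals_Archimedean2 by blast
          have "\<forall>\<^sub>F k in sequentially. max 0 (1 - real k * infdist s C) = 0"
          proof (rule eventually_sequentiallyI)
            fix k assume "k0 \<le> k"
            then have "1 / infdist s C < k"
              using k0 by linarith
            then have "1 < real k * infdist s C"
              using pos by (simp add: field_simps)
            then show "max 0 (1 - real k * infdist s C) = 0" by simp
          qed
          then show ?thesis
            using False by (simp add: tendsto_eventually)
        qed simp
      qed
      show "AE s in Q. norm (max 0 (1 - real k * infdist s C)) \<le> 1" for k
        by (intro AE_I2) (auto simp: infdist_nonneg)
    qed auto
  qed
  \<comment> \<open>Both measures are viewed in the plane, where the closed sets generate
    \<open>borel\<close>; they are restricted to the circle again at the end.\<close>
  have D: "distr M borel (\<lambda>s. s) = distr N borel (\<lambda>s. s)"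
  proof (rule measure_eqI_generator_eq[where E = "Collect closed" and \<Omega> = UNIV and A = "\<lambda>_. UNIV"])
    fix C :: "complex set" assume "C \<in> Collect closed"
    then have C: "closed C" by simp
    show "emeasure (distr M borel (\<lambda>s. s)) C = emeasure (distr N borel (\<lambda>s. s)) C"
    \<comment> \<open>\<open>infdist\<close> to the empty set is \<open>0\<close> by convention, so
      there the approximating functions would be constantly \<open>1\<close>.\<close>
    proof (cases "C = {}")
      case False
      have "(\<integral>s. indicator C s \<partial>M) = ((\<integral>s. indicator C s \<partial>N) :: real)"
      proof (rule LIMSEQ_unique)
        show "(\<lambda>k. \<integral>s. max 0 (1 - real k * infdist s C) \<partial>M) \<longlonglongrightarrow> (\<integral>s. indicator C s \<partial>M)"
          by (intro lim M.finite_measure_axioms sets C False)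
        have "(\<integral>s. max 0 (1 - real k * infdist s C) \<partial>M) = (\<integral>s. max 0 (1 - real k * infdist s C) \<partial>N)" for k
          by (intro circle_integral_continuous_eq assms continuous_intros)
        moreover have "(\<lambda>k. \<integral>s. max 0 (1 - real k * infdist s C) \<partial>N) \<longlonglongrightarrow> (\<integral>s. indicator C s \<partial>N)"
          by (intro lim N.finite_measure_axioms sets C False)
        ultimately show "(\<lambda>k. \<integral>s. max 0 (1 - real k * infdist s C) \<partial>M) \<longlonglongrightarrow> (\<integral>s. indicator C s \<partial>N)"
          by simp
      qed
      then have "measure M (C \<inter> space M) = measure N (C \<inter> space N)"
        by simp
      then show ?thesis
        using C id by (simp add: emeasure_distr M.emeasure_eq_measure N.emeasure_eq_measure)
    qed simp
  next
    show "Int_stable (Collect closed)" by (auto simp: Int_stable_def)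
  qed (use M.emeasure_space_1 N.emeasure_space_1 id in \<open>auto simp: borel_eq_closed emeasure_distr\<close>)
  show ?thesis
  proof (rule measure_eqI)
    fix A assume "A \<in> sets M"
    then have A: "A \<in> sets borel" "A \<subseteq> sphere 0 1"
      using sets by (auto simp: sets_circle_borel_iff)
    have "emeasure (distr M borel (\<lambda>s. s)) A = emeasure M A"
      using A id space_circle[OF sets(1)] by (simp add: emeasure_distr Int_absorb2)
    moreover have "emeasure (distr N borel (\<lambda>s. s)) A = emeasure N A"
      using A id space_circle[OF sets(2)] by (simp add: emeasure_distr Int_absorb2)
    ultimately show "emeasure M A = emeasure N A"
      using D by simp
  qed (use sets in simp)
qed

section \<open>Positive definite kernels\<close>

text \<open>The index type may be infinite, hence the finite subsets \<open>I\<close>. Membership in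
  the non-negative reals demands that the quadratic form be real as well as non-negative.\<close>

definition pos_def_kernel :: "('i \<Rightarrow> 'i \<Rightarrow> complex) \<Rightarrow> bool" where
  "pos_def_kernel A \<longleftrightarrow>
     (\<forall>I z. finite I \<longrightarrow> (\<Sum>i\<in>I. \<Sum>j\<in>I. A i j * (z i * cnj (z j))) \<in> \<real>\<^sub>\<ge>\<^sub>0)"

lemma pos_def_kernel_0: "pos_def_kernel (\<lambda>_ _. 0)"
  by (simp add: pos_def_kernel_def)

lemma pos_def_kernel_1: "pos_def_kernel (\<lambda>_ _. 1)"
  unfolding pos_def_kernel_def
proof (intro allI impI)
  fix I :: "'a set" and z
  have "(\<Sum>i\<in>I. \<Sum>j\<in>I. 1 * (z i * cnj (z j))) = (\<Sum>i\<in>I. z i) * cnj (\<Sum>i\<in>I. z i)"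
    by (simp add: sum_product)
  then show "(\<Sum>i\<in>I. \<Sum>j\<in>I. 1 * (z i * cnj (z j))) \<in> \<real>\<^sub>\<ge>\<^sub>0"
    unfolding complex_norm_square[symmetric] by (simp only: nonneg_Reals_of_real_iff flip: of_real_power) simp
qed

lemma pos_def_kernel_add:
  assumes "pos_def_kernel A" "pos_def_kernel B"
  shows "pos_def_kernel (\<lambda>i j. A i j + B i j)"
  using assms by (auto simp: pos_def_kernel_def distrib_right sum.distrib)

lemma pos_def_kernel_scaleR:
  assumes "pos_def_kernel A" "0 \<le> r"
  shows "pos_def_kernel (\<lambda>i j. r *\<^sub>R A i j)"
  unfolding pos_def_kernel_def
proof (intro allI impI)
  fix I :: "'a set" and z assume "finite I"
  have "(\<Sum>i\<in>I. \<Sum>j\<in>I. r *\<^sub>R A i j * (z i * cnj (z j)))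
      = of_real r * (\<Sum>i\<in>I. \<Sum>j\<in>I. A i j * (z i * cnj (z j)))"
    by (simp add: sum_distrib_left scaleR_conv_of_real mult.assoc)
  then show "(\<Sum>i\<in>I. \<Sum>j\<in>I. r *\<^sub>R A i j * (z i * cnj (z j))) \<in> \<real>\<^sub>\<ge>\<^sub>0"
    using assms \<open>finite I\<close> by (simp add: pos_def_kernel_def)
qed

text \<open>The factor \<open>w\<close> is absorbed into the test vector \<open>z\<close>.\<close>

lemma pos_def_kernel_mult_rank_one:
  assumes "pos_def_kernel A"
  shows "pos_def_kernel (\<lambda>i j. A i j * (w i * cnj (w j)))"
  unfolding pos_def_kernel_def
proof (intro allI impI)
  fix I :: "'a set" and z assume "finite I"
  have "(\<Sum>i\<in>I. \<Sum>j\<in>I. A i j * (w i * cnj (w j)) * (z i * cnj (z j)))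
      = (\<Sum>i\<in>I. \<Sum>j\<in>I. A i j * ((w i * z i) * cnj (w j * z j)))"
    by (simp add: mult_ac)
  then show "(\<Sum>i\<in>I. \<Sum>j\<in>I. A i j * (w i * cnj (w j)) * (z i * cnj (z j))) \<in> \<real>\<^sub>\<ge>\<^sub>0"
    using assms[unfolded pos_def_kernel_def, rule_format, OF \<open>finite I\<close>, of "\<lambda>i. w i * z i"] by simp
qed

lemma pos_def_kernel_limit:
  assumes "\<And>n. pos_def_kernel (A n)" "\<And>i j. (\<lambda>n. A n i j) \<longlonglongrightarrow> B i j"
  shows "pos_def_kernel B"
  unfolding pos_def_kernel_def
proof (intro allI impI)
  fix I :: "'a set" and z assume "finite I"
  have "(\<lambda>n. \<Sum>i\<in>I. \<Sum>j\<in>I. A n i j * (z i * cnj (z j)))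
      \<longlonglongrightarrow> (\<Sum>i\<in>I. \<Sum>j\<in>I. B i j * (z i * cnj (z j)))"
    by (intro tendsto_intros assms)
  then show "(\<Sum>i\<in>I. \<Sum>j\<in>I. B i j * (z i * cnj (z j))) \<in> \<real>\<^sub>\<ge>\<^sub>0"
  proof (rule closed_sequentially[OF closed_nonneg_Reals_complex, rotated])
    show "(\<Sum>i\<in>I. \<Sum>j\<in>I. A n i j * (z i * cnj (z j))) \<in> \<real>\<^sub>\<ge>\<^sub>0" for n
      using assms(1) \<open>finite I\<close> by (auto simp: pos_def_kernel_def)
  qed
qed

text \<open>A form of the Schur product theorem: for each fixed \<open>s\<close> the product with
  the rank-one kernel is positive definite, and the quadratic form of the product is the integral
  over \<open>s\<close> of these non-negative values.\<close>

lemma pos_def_kernel_mult_gram: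
  assumes A: "pos_def_kernel A"
    and int: "\<And>i j. integrable M (\<lambda>s. f i s * cnj (f j s))"
  shows "pos_def_kernel (\<lambda>i j. A i j * (\<integral>s. f i s * cnj (f j s) \<partial>M))"
  unfolding pos_def_kernel_def
proof (intro allI impI)
  fix I :: "'a set" and z assume I: "finite I"
  define g where "g s = (\<Sum>i\<in>I. \<Sum>j\<in>I. A i j * (f i s * cnj (f j s)) * (z i * cnj (z j)))" for s
  have g: "g s \<in> \<real>\<^sub>\<ge>\<^sub>0" for s
    using pos_def_kernel_mult_rank_one[OF A, of "\<lambda>i. f i s"] I
    unfolding g_def pos_def_kernel_def by blast
  have int_g: "integrable M g"
    unfolding g_def by (intro Bochner_Integration.integrable_sum integrable_mult_left integrable_mult_right int)
  have "(\<Sum>i\<in>I. \<Sum>j\<in>I. A i j * (\<integral>s. f i s * cnj (f j s) \<partial>M) * (z i * cnj (z j)))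
      = (\<Sum>i\<in>I. \<Sum>j\<in>I. \<integral>s. A i j * (f i s * cnj (f j s)) * (z i * cnj (z j)) \<partial>M)"
    by (simp only: integral_mult_left_zero integral_mult_right_zero)
  also have "\<dots> = (\<integral>s. g s \<partial>M)"
    unfolding g_def
    by (simp only: Bochner_Integration.integral_sum Bochner_Integration.integrable_sum
          integrable_mult_left integrable_mult_right int)
  also have "\<dots> \<in> \<real>\<^sub>\<ge>\<^sub>0"
  proof -
    have "0 \<le> (\<integral>s. Re (g s) \<partial>M)" "(\<integral>s. Im (g s) \<partial>M) = 0"
      using g by (auto simp: complex_nonneg_Reals_iff)
    then show ?thesis
      using int_g by (simp add: complex_nonneg_Reals_iff)
  qed
  finally show "(\<Sum>i\<in>I. \<Sum>j\<in>I. A i j * (\<integral>s. f i s * cnj (f j s) \<partial>M) * (z i * cnj (z j))) \<in> \<real>\<^sub>\<ge>\<^sub>0" .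
qed

text \<open>Powers of a Gram kernel are positive definite by repeated Schur products. The partial
  sums of the exponential series combine them with positive coefficients, and positivity survives
  the limit.\<close>

lemma pos_def_kernel_exp_gram:
  assumes int: "\<And>i j. integrable M (\<lambda>s. f i s * cnj (f j s))"
  shows "pos_def_kernel (\<lambda>i j. exp (\<integral>s. f i s * cnj (f j s) \<partial>M))"
proof (rule pos_def_kernel_limit)
  define K where "K i j = (\<integral>s. f i s * cnj (f j s) \<partial>M)" for i j
  have power: "pos_def_kernel (\<lambda>i j. K i j ^ n)" for n
  proof (induction n)
    case (Suc n)
    have "pos_def_kernel (\<lambda>i j. K i j ^ n * (\<integral>s. f i s * cnj (f j s) \<partial>M))"
      by (rule pos_def_kernel_mult_gram[OF Suc int])
    then show ?case
      by (simp add: K_def mult.commute)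
  qed (simp add: pos_def_kernel_1)
  show "pos_def_kernel (\<lambda>i j. \<Sum>m<n. K i j ^ m /\<^sub>R fact m)" for n
  proof (induction n)
    case (Suc n)
    then show ?case
      unfolding sum.lessThan_Suc by (intro pos_def_kernel_add pos_def_kernel_scaleR power) auto
  qed (simp add: pos_def_kernel_0)
  show "(\<lambda>n. \<Sum>m<n. K i j ^ m /\<^sub>R fact m) \<longlonglongrightarrow> exp (\<integral>s. f i s * cnj (f j s) \<partial>M)" for i j
    using exp_converges[of "K i j"] unfolding sums_def K_def by simp
qed

text \<open>This identity makes the exponent conditionally positive definite.\<close>

lemma levy_kernel_diff:
  assumes "norm s = 1"
  shows "(s powi j - 1) * cnj (s powi k - 1)
      = levy_kernel (j - k) s - levy_kernel j s - cnj (levy_kernel k s)"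
proof -
  obtain t where s: "s = cis t"
    using circle_cases[OF assms] by blast
  have "of_int (j - k) * t = of_int j * t + - (of_int k * t)"
    by (simp add: algebra_simps)
  then have "cis (of_int (j - k) * t) = cis (of_int j * t) * cnj (cis (of_int k * t))"
    by (simp only: cis_mult[symmetric] cis_cnj)
  then show ?thesis
    unfolding s levy_kernel_def cis_power_int by (simp add: algebra_simps)
qed

text \<open>The argument of Schoenberg: by \<open>levy_kernel_diff\<close>, the exponent at
  \<open>j - k\<close> is a Gram kernel plus a function of \<open>j\<close> plus the conjugate of
  the same function of \<open>k\<close>. Exponentiating gives the exponential of a Gram kernel times
  a rank-one kernel.\<close>

lemma pos_def_kernel_exp_levy_exponent:
  assumes \<rho>: "levy_measure \<rho>"
  shows "pos_def_kernel (\<lambda>j k. exp (levy_exponent \<rho> (j - k)))"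
proof -
  have int: "integrable \<rho> (levy_kernel n)" for n
    by (rule integrable_levy_kernel[OF \<rho>])
  have norm: "norm s = 1" if "s \<in> space \<rho>" for s
    using that \<rho> space_circle[of \<rho>] by (auto simp: levy_measure_def)
  have eq: "(s powi j - 1) * cnj (s powi k - 1)
      = levy_kernel (j - k) s - levy_kernel j s - cnj (levy_kernel k s)" if "s \<in> space \<rho>" for s j k
    using that by (intro levy_kernel_diff norm)
  have gram_int: "integrable \<rho> (\<lambda>s. (s powi j - 1) * cnj (s powi k - 1))" for j k
  proof -
    have "integrable \<rho> (\<lambda>s. levy_kernel (j - k) s - levy_kernel j s - cnj (levy_kernel k s))"
      by (intro Bochner_Integration.integrable_diff integrable_cnj int)
    then show ?thesis
      by (simp only: eq cong: Bochner_Integration.integrable_cong)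
  qed
  have gram: "(\<integral>s. (s powi j - 1) * cnj (s powi k - 1) \<partial>\<rho>)
      = levy_exponent \<rho> (j - k) - levy_exponent \<rho> j - cnj (levy_exponent \<rho> k)" for j k
  proof -
    have "(\<integral>s. (s powi j - 1) * cnj (s powi k - 1) \<partial>\<rho>)
        = (\<integral>s. levy_kernel (j - k) s - levy_kernel j s - cnj (levy_kernel k s) \<partial>\<rho>)"
      by (simp only: eq cong: Bochner_Integration.integral_cong)
    also have "\<dots> = levy_exponent \<rho> (j - k) - levy_exponent \<rho> j - cnj (levy_exponent \<rho> k)"
      unfolding levy_exponent_def
      by (simp add: int)
    finally show ?thesis .
  qed
  have "pos_def_kernel (\<lambda>j k. exp (\<integral>s. (s powi j - 1) * cnj (s powi k - 1) \<partial>\<rho>)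
      * (exp (levy_exponent \<rho> j) * cnj (exp (levy_exponent \<rho> k))))"
    by (rule pos_def_kernel_mult_rank_one, rule pos_def_kernel_exp_gram, rule gram_int)
  moreover have "exp (\<integral>s. (s powi j - 1) * cnj (s powi k - 1) \<partial>\<rho>)
      * (exp (levy_exponent \<rho> j) * cnj (exp (levy_exponent \<rho> k))) = exp (levy_exponent \<rho> (j - k))" for j k
    by (simp only: gram exp_cnj exp_add[symmetric]) simp
  ultimately show ?thesis
    by simp
qed

section \<open>The theorem of Herglotz\<close>

text \<open>Orthogonality of the characters: for \<open>m \<noteq> 0\<close> the antiderivative
  takes the same value at both ends of the period.\<close>

lemma has_bochner_integral_cis:
  "has_bochner_integral lborel (\<lambda>x. indicator {- pi..pi} x *\<^sub>R cis (of_int m * x))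
     (if m = 0 then of_real (2 * pi) else 0)"
proof (cases "m = 0")
  case True
  have "has_bochner_integral lborel (\<lambda>x. indicator {- pi..pi} x *\<^sub>R (1::complex)) (measure lborel {- pi..pi} *\<^sub>R 1)"
    by (intro has_bochner_integral_scaleR_left has_bochner_integral_real_indicator) auto
  then show ?thesis
    using True by (simp add: scaleR_conv_of_real)
next
  case False
  define F where "F x = cis (of_int m * x) / (\<i> * of_int m)" for x
  have "has_bochner_integral lborel (\<lambda>x. indicator {- pi..pi} x *\<^sub>R cis (of_int m * x)) (F pi - F (- pi))"
  proof (rule has_bochner_integral_FTC_Icc)
    show "(F has_vector_derivative cis (of_int m * x)) (at x within {- pi..pi})" for x
    proof -
      have "((\<lambda>z. exp (\<i> * (of_int m * z)) / (\<i> * of_int m)) has_field_derivative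
          exp (\<i> * (of_int m * of_real x))) (at (of_real x))"
        using False by  (auto intro!: derivative_eq_intros simp: complex_eq_iff)
      from has_vector_derivative_real_field[OF this, of "{- pi..pi}"] show ?thesis
        by (simp add: F_def[abs_def] cis_conv_exp)
    qed
    show "continuous_on {- pi..pi} (\<lambda>x. cis (of_int m * x))"
      by (intro continuous_intros)
  qed auto
  moreover have "cis (of_int m * pi) = cis (- (of_int m * pi))"
  proof -
    have "sin (of_int m * pi) = 0"
      by (simp add: sin_zero_iff_int2)
    then show ?thesis
      by (simp add: complex_eq_iff)
  qed
  ultimately show ?thesis
    using False by (simp add: F_def)
qed

text \<open>This is \<open>N\<close> times the Fejer mean of the Fourier series with coefficients
  \<open>a m\<close> at \<open>cis (- m * x)\<close>. Written as a double sum it is the quadratic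
  form of \<open>a (j - k)\<close> at the vector \<open>cis (- j * x)\<close>, hence non-negative
  for positive definite \<open>a\<close>.\<close>

definition fejer_sum :: "(int \<Rightarrow> complex) \<Rightarrow> nat \<Rightarrow> real \<Rightarrow> complex" where
  "fejer_sum a N x =
     (\<Sum>j\<in>{0..<int N}. \<Sum>k\<in>{0..<int N}. a (j - k) * (cis (- of_int j * x) * cnj (cis (- of_int k * x))))"

lemma fejer_sum_nonneg:
  assumes "pos_def_kernel (\<lambda>j k. a (j - k))"
  shows "fejer_sum a N x \<in> \<real>\<^sub>\<ge>\<^sub>0"
  using assms unfolding pos_def_kernel_def fejer_sum_def by simp

text \<open>By orthogonality only the pairs with \<open>j - k = n\<close> survive. There are
  \<open>N - \<bar>n\<bar>\<close> of them, or none if \<open>\<bar>n\<bar> \<ge> N\<close>, which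
  is what \<open>nat\<close> expresses.\<close>

lemma fejer_sum_moment:
  "has_bochner_integral lborel (\<lambda>x. indicator {- pi..pi} x *\<^sub>R (fejer_sum a N x * cis (of_int n * x)))
     (of_real (2 * pi * nat (int N - \<bar>n\<bar>)) * a n)"
proof -
  have count: "(\<Sum>j\<in>{0..<int N}. \<Sum>k\<in>{0..<int N}. if n - j + k = 0 then c else 0) = of_nat (nat (int N - \<bar>n\<bar>)) * c"
    for c :: complex
  proof -
    have "(\<Sum>j\<in>{0..<int N}. \<Sum>k\<in>{0..<int N}. if n - j + k = 0 then c else 0)
        = (\<Sum>j\<in>{0..<int N}. \<Sum>k\<in>{0..<int N}. if k = j - n then c else 0)"
      by (intro sum.cong refl if_cong) auto
    also have "\<dots> = (\<Sum>j\<in>{0..<int N}. if j \<in> {n..<int N + n} then c else 0)"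
      by (intro sum.cong refl) (auto simp: sum.delta)
    also have "\<dots> = (\<Sum>j\<in>{0..<int N} \<inter> {n..<int N + n}. c)"
      by (intro sum.inter_restrict[symmetric]) simp
    also have "\<dots> = of_nat (card {max 0 n..<min (int N) (int N + n)}) * c"
      by (simp only: sum_constant) (simp add: Int_atLeastLessThan)
    also have "card {max 0 n..<min (int N) (int N + n)} = nat (int N - \<bar>n\<bar>)"
      by (simp add: min_def max_def)
    finally show ?thesis .
  qed
  have "has_bochner_integral lborel
      (\<lambda>x. \<Sum>j\<in>{0..<int N}. \<Sum>k\<in>{0..<int N}. a (j - k) * (indicator {- pi..pi} x *\<^sub>R cis (of_int (n - j + k) * x)))
      (\<Sum>j\<in>{0..<int N}. \<Sum>k\<in>{0..<int N}. a (j - k) * (if n - j + k = 0 then of_real (2 * pi) else 0))"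
    by (intro has_bochner_integral_sum has_bochner_integral_mult_right has_bochner_integral_cis)
  also have "(\<lambda>x. \<Sum>j\<in>{0..<int N}. \<Sum>k\<in>{0..<int N}. a (j - k) * (indicator {- pi..pi} x *\<^sub>R cis (of_int (n - j + k) * x)))
      = (\<lambda>x. indicator {- pi..pi} x *\<^sub>R (fejer_sum a N x * cis (of_int n * x)))"
  proof
    fix x
    have "cis (of_int (n - j + k) * x) = cis (- of_int j * x) * cnj (cis (- of_int k * x)) * cis (of_int n * x)" for j k
      by (simp add: cis_cnj cis_mult algebra_simps)
    then show "(\<Sum>j\<in>{0..<int N}. \<Sum>k\<in>{0..<int N}. a (j - k) * (indicator {- pi..pi} x *\<^sub>R cis (of_int (n - j + k) * x)))
      = indicator {- pi..pi} x *\<^sub>R (fejer_sum a N x * cis (of_int n * x))"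
      by (simp only: fejer_sum_def sum_distrib_right scaleR_sum_right mult_scaleR_right mult.assoc)
  qed
  also have "(\<Sum>j\<in>{0..<int N}. \<Sum>k\<in>{0..<int N}. a (j - k) * (if n - j + k = 0 then of_real (2 * pi) else 0))
      = (\<Sum>j\<in>{0..<int N}. \<Sum>k\<in>{0..<int N}. if n - j + k = 0 then of_real (2 * pi) * a n else 0)"
    by (intro sum.cong refl) (auto simp: algebra_simps)
  also have "\<dots> = of_real (2 * pi * nat (int N - \<bar>n\<bar>)) * a n"
    by (simp add: count)
  finally show ?thesis .
qed

text \<open>The normalised Fejer means are probability densities on \<open>[-pi, pi]\<close> whose
  \<open>n\<close>-th moments tend to \<open>a n\<close>. Compact support gives tightness, hence a
  weakly convergent subsequence, and the limit is wrapped onto the circle by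
  \<open>cis\<close>.\<close>

theorem herglotz:
  fixes a :: "int \<Rightarrow> complex"
  assumes a0: "a 0 = 1" and pd: "pos_def_kernel (\<lambda>j k. a (j - k))"
  shows "\<exists>\<nu>. prob_space \<nu> \<and> sets \<nu> = sets circle_borel \<and> (\<forall>n. (\<integral>s. s powi n \<partial>\<nu>) = a n)"
proof -
  \<comment> \<open>Starting at \<open>Suc N\<close> keeps the divisor non-zero; the factor
    \<open>2 * pi * Suc N\<close> makes the total mass equal to \<open>a 0\<close>.\<close>
  define p where "p N x = indicator {- pi..pi} x * (Re (fejer_sum a (Suc N) x) / (2 * pi * Suc N))" for N x
  define \<mu> where "\<mu> N = density lborel (\<lambda>x. ennreal (p N x))" for N
  have p_nonneg: "0 \<le> p N x" for N x
    using fejer_sum_nonneg[OF pd, of "Suc N" x] by (simp add: p_def complex_nonneg_Reals_iff)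
  have fejer_Re: "of_real (Re (fejer_sum a N x)) = fejer_sum a N x" for N x
    using fejer_sum_nonneg[OF pd, of N x] by (simp add: complex_nonneg_Reals_iff complex_eq_iff)
  have [measurable]: "p N \<in> borel_measurable borel" for N
  proof -
    have [measurable]: "fejer_sum a (Suc N) \<in> borel_measurable borel"
      unfolding fejer_sum_def[abs_def]
      by (intro borel_measurable_continuous_onI continuous_intros)
    show ?thesis
      unfolding p_def[abs_def] by measurable
  qed
  have moment: "has_bochner_integral lborel (\<lambda>x. p N x *\<^sub>R cis (of_int n * x))
      (of_real (nat (int (Suc N) - \<bar>n\<bar>) / Suc N) * a n)" for N n
  proof -
    have "has_bochner_integral lborel
        (\<lambda>x. indicator {- pi..pi} x *\<^sub>R (fejer_sum a (Suc N) x * cis (of_int n * x)) / of_real (2 * pi * Suc N))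
        (of_real (2 * pi * nat (int (Suc N) - \<bar>n\<bar>)) * a n / of_real (2 * pi * Suc N))"
      by (intro has_bochner_integral_divide_zero fejer_sum_moment)
    moreover have "indicator {- pi..pi} x *\<^sub>R (fejer_sum a (Suc N) x * cis (of_int n * x)) / of_real (2 * pi * Suc N)
        = p N x *\<^sub>R cis (of_int n * x)" for x
      by (subst fejer_Re[symmetric]) (simp add: p_def scaleR_conv_of_real)
    ultimately show ?thesis
      by simp
  qed
  \<comment> \<open>The total mass is the moment with \<open>n = 0\<close>.\<close>
  have "has_bochner_integral lborel (p N) 1" for N
    using has_bochner_integral_Re[OF moment[of N 0]] by (simp add: a0)
  then have "(\<integral>\<^sup>+x. ennreal (p N x) \<partial>lborel) = 1" for N
    using p_nonneg by (simp add: has_bochner_integral_iff nn_integral_eq_integral)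
  then have prob: "prob_space (\<mu> N)" for N
    by (intro prob_spaceI) (simp add: \<mu>_def emeasure_density cong: nn_integral_cong)
  have rd: "real_distribution (\<mu> N)" for N
    using prob by (simp add: real_distribution_def real_distribution_axioms_def \<mu>_def)
  have \<mu>_moment: "(\<integral>x. cis (of_int n * x) \<partial>\<mu> N) = of_real (nat (int (Suc N) - \<bar>n\<bar>) / Suc N) * a n" for n N
  proof -
    have "(\<integral>x. cis (of_int n * x) \<partial>\<mu> N) = (\<integral>x. p N x *\<^sub>R cis (of_int n * x) \<partial>lborel)"
      unfolding \<mu>_def using p_nonneg
      by (intro integral_density) (auto intro!: borel_measurable_continuous_onI continuous_intros)
    then show ?thesis
      using moment[of N n] by (simp add: has_bochner_integral_iff)
  qed
  \<comment> \<open>A half-open interval is the form that \<open>tight\<close> asks for; this one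
    contains \<open>[-pi, pi]\<close> because \<open>pi < 4\<close>.\<close>
  have "measure (\<mu> N) {-4<..4} = 1" for N
  proof -
    interpret prob_space "\<mu> N" by (rule prob)
    have "AE x in \<mu> N. x \<in> {-4<..4}"
      unfolding \<mu>_def
      by (subst AE_density, simp, rule AE_I2) (use pi_less_4 in \<open>auto simp: p_def split: split_indicator_asm\<close>)
    then show ?thesis
      by (subst prob_eq_1) (auto simp: \<mu>_def)
  qed
  then have "tight \<mu>"
    unfolding tight_def using rd by (intro conjI allI impI exI[of _ "-4"] exI[of _ 4]) simp_all
  \<comment> \<open>The selection theorem extracts from a given subsequence, here the whole
    sequence; hence the \<open>id\<close>.\<close>
  then obtain r M where r: "strict_mono r" and M: "real_distribution M"
    and conv: "weak_conv_m (\<mu> \<circ> id \<circ> r) M"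
    using tight_imp_convergent_subsubsequence strict_mono_id by blast
  interpret M: real_distribution M by (rule M)
  have M_moment: "(\<integral>x. cis (of_int n * x) \<partial>M) = a n" for n
  proof (rule LIMSEQ_unique)
    have "continuous_on UNIV (\<lambda>x. cis (of_int n * x))"
      by (intro continuous_intros)
    then have "isCont (\<lambda>x. cis (of_int n * x)) x" for x
      by (simp add: continuous_on_eq_continuous_at)
    then show "(\<lambda>k. \<integral>x. cis (of_int n * x) \<partial>(\<mu> \<circ> id \<circ> r) k) \<longlonglongrightarrow> (\<integral>x. cis (of_int n * x) \<partial>M)"
      by (intro weak_conv_imp_integral_bdd_continuous_conv[OF _ M conv, where B = 1]) (simp_all add: rd)
    have "(\<lambda>N. real (nat (int (Suc N) - \<bar>n\<bar>)) / Suc N) \<longlonglongrightarrow> 1"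
    proof (rule Lim_transform_eventually)
      show "(\<lambda>N. 1 - \<bar>of_int n\<bar> * inverse (real (Suc N))) \<longlonglongrightarrow> 1"
        using tendsto_diff[OF tendsto_const tendsto_mult_right_zero[OF LIMSEQ_inverse_real_of_nat]] by simp
      show "\<forall>\<^sub>F N in sequentially. 1 - \<bar>of_int n\<bar> * inverse (real (Suc N)) = real (nat (int (Suc N) - \<bar>n\<bar>)) / Suc N"
        by (rule eventually_sequentiallyI[of "nat \<bar>n\<bar>"]) (simp add: field_simps of_nat_nat)
    qed
    then have "(\<lambda>N. of_real (real (nat (int (Suc N) - \<bar>n\<bar>)) / Suc N) * a n) \<longlonglongrightarrow> of_real 1 * a n"
      by (intro tendsto_intros)
    then have "(\<lambda>N. \<integral>x. cis (of_int n * x) \<partial>\<mu> N) \<longlonglongrightarrow> a n"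
      by (simp add: \<mu>_moment)
    from LIMSEQ_subseq_LIMSEQ[OF this r]
    show "(\<lambda>k. \<integral>x. cis (of_int n * x) \<partial>(\<mu> \<circ> id \<circ> r) k) \<longlonglongrightarrow> a n"
      by (simp add: o_def)
  qed
  have cis_meas: "cis \<in> M \<rightarrow>\<^sub>M circle_borel"
    unfolding circle_borel_def
    by (intro measurable_restrict_space2) (auto intro!: borel_measurable_continuous_onI continuous_intros simp: measurable_cong_sets[OF M.events_eq_borel refl])
  show ?thesis
  proof (intro exI conjI allI)
    show "prob_space (distr M circle_borel cis)"
      by (rule M.prob_space_distr[OF cis_meas])
    have "(\<lambda>s. s powi n) \<in> borel_measurable circle_borel" for n
      by (rule borel_measurable_circle) auto
    then show "(\<integral>s. s powi n \<partial>distr M circle_borel cis) = a n" for n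
      by (subst integral_distr[OF cis_meas]) (simp_all add: cis_power_int M_moment)
  qed simp
qed

section \<open>Levy classes of two-point measures\<close>

text \<open>Shows that the description inside \<open>THE\<close> has exactly one solution. Only then
  does equality of two \<open>nu_circ\<close> measures say anything about the exponents.\<close>

lemma nu_circ_moments:
  assumes \<rho>: "levy_measure \<rho>"
  shows "prob_space (nu_circ \<rho>)" "sets (nu_circ \<rho>) = sets circle_borel"
    "(\<integral>s. s powi n \<partial>nu_circ \<rho>) = exp (levy_exponent \<rho> n)"
proof -
  define P where "P \<nu> \<longleftrightarrow> prob_space \<nu> \<and> sets \<nu> = sets circle_borel \<and>
      (\<forall>n::int. (\<integral>s. s powi n \<partial>\<nu>) = exp (levy_exponent \<rho> n))" for \<nu> :: "complex measure"
  have "levy_kernel 0 = (\<lambda>_. 0)"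
    by (simp add: levy_kernel_def fun_eq_iff)
  then have "exp (levy_exponent \<rho> 0) = 1"
    by (simp add: levy_exponent_def)
  then obtain \<nu> where "P \<nu>"
    unfolding P_def using herglotz[OF _ pos_def_kernel_exp_levy_exponent[OF \<rho>]] by blast
  moreover have "\<nu>' = \<nu>" if "P \<nu>'" for \<nu>'
    using that \<open>P \<nu>\<close> unfolding P_def by (intro circle_moments_unique) auto
  ultimately have "P (THE \<nu>. P \<nu>)"
    by (rule theI)
  then have "P (nu_circ \<rho>)"
    unfolding nu_circ_def P_def levy_exponent_def levy_kernel_def .
  then show "prob_space (nu_circ \<rho>)" "sets (nu_circ \<rho>) = sets circle_borel"
    "(\<integral>s. s powi n \<partial>nu_circ \<rho>) = exp (levy_exponent \<rho> n)"
    unfolding P_def by auto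
qed

lemma levy_class_exponent:
  assumes "levy_measure \<rho>" "\<rho>' \<in> levy_class \<rho>"
  shows "exp (levy_exponent \<rho>' n) = exp (levy_exponent \<rho> n)"
  using assms nu_circ_moments(3)[of \<rho> n] nu_circ_moments(3)[of \<rho>' n] by (simp add: levy_class_def)

section \<open>Two-point measures and integration against them\<close>

lemma sets_two_point_measure [simp]: "sets (two_point_measure c a d b) = sets circle_borel"
  by (simp only: two_point_measure_def sets.sets_measure_of_eq)

context
  fixes c d :: real and a b :: complex
  assumes nonneg: "0 \<le> c" "0 \<le> d" and norm: "norm a = 1" "norm b = 1"
begin

abbreviation (input) "two_point_weights \<equiv> point_measure UNIV (\<lambda>x. ennreal (if x then c else d))"

lemma measurable_two_point: "(\<lambda>x. if x then a else b) \<in> two_point_weights \<rightarrow>\<^sub>M circle_borel"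
  using norm by (auto simp: space_point_measure)

lemma emeasure_distr_two_point:
  assumes "A \<in> sets circle_borel"
  shows "emeasure (distr two_point_weights circle_borel (\<lambda>x. if x then a else b)) A
    = ennreal c * indicator A a + ennreal d * indicator A b" (is "emeasure ?D A = _")
proof -
  have "emeasure ?D A = (\<Sum>x\<in>(\<lambda>x. if x then a else b) -` A. ennreal (if x then c else d))"
    by (subst emeasure_distr[OF measurable_two_point assms])
      (simp add: space_point_measure emeasure_point_measure_finite)
  also have "\<dots> = (\<Sum>x\<in>UNIV. ennreal (if x then c else d) * indicator A (if x then a else b))"
    by (intro sum.mono_neutral_cong_left) (auto simp: indicator_def)
  also have "\<dots> = ennreal c * indicator A a + ennreal d * indicator A b"
    by (simp add: UNIV_bool add.commute del: sum_mult_indicator)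
  finally show ?thesis .
qed

text \<open>\<open>measure_of\<close> keeps the given set function only if that function is a
  measure. Realising it as the image of a weighted measure on \<open>bool\<close> provides this, and
  it also covers \<open>a = b\<close>.\<close>

lemma two_point_measure_eq_distr:
  "two_point_measure c a d b = distr two_point_weights circle_borel (\<lambda>x. if x then a else b)"
  (is "_ = ?D")
proof -
  have "two_point_measure c a d b = measure_of (space circle_borel) (sets circle_borel) (emeasure ?D)"
    unfolding two_point_measure_def
    by (intro measure_of_eq sets.space_closed)
      (simp only: emeasure_distr_two_point sets.sigma_sets_eq)
  also have "\<dots> = ?D"
    using measure_of_of_measure[of ?D] by simp
  finally show ?thesis .
qed

lemma emeasure_two_point_measure:
  assumes "A \<in> sets circle_borel"
  shows "emeasure (two_point_measure c a d b) A = ennreal c * indicator A a + ennreal d * indicator A b"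
  using assms by (simp add: two_point_measure_eq_distr emeasure_distr_two_point)

lemma has_bochner_integral_two_point_measure:
  fixes f :: "complex \<Rightarrow> 'b::{banach, second_countable_topology}"
  assumes "f \<in> borel_measurable borel"
  shows "has_bochner_integral (two_point_measure c a d b) f (c *\<^sub>R f a + d *\<^sub>R f b)"
proof -
  have f: "f \<in> borel_measurable circle_borel"
    by (rule borel_measurable_circle) (use assms in auto)
  have "integrable two_point_weights (\<lambda>x. f (if x then a else b))"
    by (intro integrable_point_measure_finite) auto
  moreover have "(\<integral>x. f (if x then a else b) \<partial>two_point_weights) = c *\<^sub>R f a + d *\<^sub>R f b"
    using nonneg by (subst lebesgue_integral_point_measure_finite) (auto simp: UNIV_bool add.commute)
  ultimately show ?thesis
    using f measurable_two_point
    by (simp add: two_point_measure_eq_distr has_bochner_integral_iff integral_distr integrable_distr_eq)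
qed

end

text \<open>The left-hand side is non-negative and vanishes on the circle only if \<open>s = 1\<close> or \<open>Re s = x\<close>,
  while its integral is determined by the exponent.\<close>

lemma levy_kernel_test_function:
  assumes "norm s = 1"
  shows "(1 - Re s) * (Re s - x)\<^sup>2 = - ((3/4 + 2 * x + x\<^sup>2) * Re (levy_kernel 1 s)
    - (1/2 + x) * Re (levy_kernel 2 s) + 1/4 * Re (levy_kernel 3 s))"
proof -
  obtain t where s: "s = cis t"
    using circle_cases[OF assms] by blast
  \<comment> \<open>With \<open>y = cos t\<close> the real parts are \<open>T\<^sub>n(y) - 1\<close>
    for the Chebyshev polynomials of the first kind. The cubic
    \<open>(1 - y) (y - x)\<^sup>2\<close> vanishes at \<open>y = 1\<close>, so it is a combination
    of these three.\<close>
  have kernel: "Re (levy_kernel 1 s) = cos t - 1" "Re (levy_kernel 2 s) = 2 * (cos t)\<^sup>2 - 2"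
    "Re (levy_kernel 3 s) = 4 * cos t ^ 3 - 3 * cos t - 1"
    by (simp_all add: s levy_kernel_cis cos_double_cos cos_treble_cos)
  show ?thesis
    unfolding kernel unfolding s by (simp add: power2_eq_square power3_eq_cube field_simps)
qed

lemma levy_measure_two_point:
  assumes "0 \<le> c" "0 \<le> d" and a: "norm a = 1" "a \<noteq> 1" and b: "norm b = 1" "b \<noteq> 1"
  shows "levy_measure (two_point_measure c a d b)"
proof -
  have "{1} \<in> sets circle_borel"
    by (simp add: sets_circle_borel_iff)
  then have "emeasure (two_point_measure c a d b) {1} = 0"
    using assms by (simp add: emeasure_two_point_measure)
  moreover have "integrable (two_point_measure c a d b) (\<lambda>s. 1 - Re s)"
    using assms has_bochner_integral_two_point_measure[of c d a b "\<lambda>s. 1 - Re s"] by (simp add: has_bochner_integral_iff)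
  ultimately show ?thesis
    by (simp add: levy_measure_def)
qed

lemma levy_exponent_two_point:
  assumes "0 \<le> c" "0 \<le> d" "norm a = 1" "norm b = 1"
  shows "levy_exponent (two_point_measure c a d b) n = c *\<^sub>R levy_kernel n a + d *\<^sub>R levy_kernel n b"
  unfolding levy_exponent_def
  by (intro has_bochner_integral_integral_eq has_bochner_integral_two_point_measure assms
      levy_kernel_borel_measurable)

text \<open>Taking absolute values of the exponentials removes the ambiguity by multiples of
  \<open>2 \<pi> \<i>\<close>.\<close>

lemma Re_levy_exponent_levy_class:
  assumes "levy_measure \<rho>" "\<rho>' \<in> levy_class \<rho>"
  shows "Re (levy_exponent \<rho>' n) = Re (levy_exponent \<rho> n)"
  using levy_class_exponent[OF assms, of n] by (metis norm_exp_eq_Re exp_inj_iff)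

text \<open>Markov's inequality: a Levy measure may have infinite mass near \<open>1\<close>, but
  the integrable weight \<open>1 - Re s\<close> is positive at \<open>a\<close>.\<close>

lemma levy_measure_finite_point:
  assumes \<rho>: "levy_measure \<rho>" and a: "norm a = 1" "a \<noteq> 1"
  shows "emeasure \<rho> {a} < \<infinity>"
proof -
  have Re: "Re a < 1"
    using norm_circle_diff_1[OF a(1)] a(2) by (metis diff_gt_0_iff_gt eq_iff_diff_eq_0 zero_less_mult_pos zero_less_norm_iff zero_less_numeral zero_less_power)
  have meas: "{a} \<in> sets \<rho>"
    using \<rho> a by (simp add: levy_measure_def sets_circle_borel_iff)
  have "integrable \<rho> (\<lambda>s. indicator {a} s :: real)"
  proof (rule Bochner_Integration.integrable_bound)
    show "integrable \<rho> (\<lambda>s. (1 - Re s) / (1 - Re a))"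
      using \<rho> by (intro integrable_divide) (simp add: levy_measure_def)
    show "AE s in \<rho>. norm (indicator {a} s :: real) \<le> norm ((1 - Re s) / (1 - Re a))"
      using Re by (intro AE_I2) (auto simp: indicator_def)
  qed (use meas in simp)
  then show ?thesis
    using meas by (simp add: integrable_indicator_iff)
qed

text \<open>The test function \<open>g\<close> vanishes at \<open>a\<close> and
  \<open>cnj a\<close>, so its integral is \<open>0\<close> for the two-point measure and, being
  fixed by the real parts of the exponent, also for \<open>\<rho>\<close>. As \<open>g\<close> is
  non-negative, \<open>\<rho>\<close> lives on its zeros, of which \<open>1\<close> is a null
  set.\<close>

lemma levy_class_two_point:
  assumes cd: "0 \<le> c" "0 \<le> d" and a: "norm a = 1" "a \<noteq> 1"
    and \<rho>: "\<rho> \<in> levy_class (two_point_measure c a d (cnj a))"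
  obtains c' d' where "0 \<le> c'" "0 \<le> d'" "\<rho> = two_point_measure c' a d' (cnj a)"
proof -
  let ?T = "two_point_measure c a d (cnj a)"
  define g where "g s = (1 - Re s) * (Re s - Re a)\<^sup>2" for s
  have a': "norm (cnj a) = 1" "cnj a \<noteq> 1"
    using a by (auto simp: complex_eq_iff)
  have T: "levy_measure ?T"
    by (intro levy_measure_two_point cd a a')
  have \<rho>': "levy_measure \<rho>"
    using \<rho> by (simp add: levy_class_def)
  then have sets: "sets \<rho> = sets circle_borel" and null: "{1} \<in> null_sets \<rho>"
    by (auto simp: levy_measure_def sets_circle_borel_iff)
  have g_integral: "has_bochner_integral Q g (- ((3/4 + 2 * Re a + (Re a)\<^sup>2) * Re (levy_exponent Q 1)
      - (1/2 + Re a) * Re (levy_exponent Q 2) + 1/4 * Re (levy_exponent Q 3)))"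
    if Q: "levy_measure Q" for Q
  proof -
    have Re: "has_bochner_integral Q (\<lambda>s. Re (levy_kernel n s)) (Re (levy_exponent Q n))" for n
      unfolding levy_exponent_def
      by (intro has_bochner_integral_Re has_bochner_integral_integrable integrable_levy_kernel Q)
    have "has_bochner_integral Q (\<lambda>s. - ((3/4 + 2 * Re a + (Re a)\<^sup>2) * Re (levy_kernel 1 s)
        - (1/2 + Re a) * Re (levy_kernel 2 s) + 1/4 * Re (levy_kernel 3 s)))
      (- ((3/4 + 2 * Re a + (Re a)\<^sup>2) * Re (levy_exponent Q 1)
        - (1/2 + Re a) * Re (levy_exponent Q 2) + 1/4 * Re (levy_exponent Q 3)))"
      by (intro has_bochner_integral_minus has_bochner_integral_add has_bochner_integral_diff
          has_bochner_integral_mult_right Re)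
    then show ?thesis
    proof (rule has_bochner_integral_cong[THEN iffD1, rotated -1])
      show "- ((3/4 + 2 * Re a + (Re a)\<^sup>2) * Re (levy_kernel 1 s)
        - (1/2 + Re a) * Re (levy_kernel 2 s) + 1/4 * Re (levy_kernel 3 s)) = g s" if "s \<in> space Q" for s
        unfolding g_def using that Q space_circle[of Q]
        by (intro levy_kernel_test_function[symmetric]) (auto simp: levy_measure_def)
    qed auto
  qed
  have "(\<integral>s. g s \<partial>\<rho>) = (\<integral>s. g s \<partial>?T)"
    using Re_levy_exponent_levy_class[OF T \<rho>] g_integral[OF T] g_integral[OF \<rho>']
    by (simp add: has_bochner_integral_iff)
  also have "(\<integral>s. g s \<partial>?T) = c *\<^sub>R g a + d *\<^sub>R g (cnj a)"
    by (intro has_bochner_integral_integral_eq has_bochner_integral_two_point_measure cd a a')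
      (simp add: g_def[abs_def])
  also have "\<dots> = 0"
    by (simp add: g_def)
  finally have "(\<integral>s. g s \<partial>\<rho>) = 0" .
  moreover have "AE s in \<rho>. 0 \<le> g s"
  proof (rule AE_I2)
    fix s assume "s \<in> space \<rho>"
    then have "norm s = 1"
      using space_circle[OF sets] by auto
    then show "0 \<le> g s"
      using complex_Re_le_cmod[of s] by (simp add: g_def)
  qed
  ultimately have "AE s in \<rho>. g s = 0"
    using g_integral[OF \<rho>'] by (simp add: has_bochner_integral_iff integral_nonneg_eq_0_iff_AE)
  then have supp: "AE s in \<rho>. s \<in> {a, cnj a}"
    using AE_not_in[OF null] AE_space
  proof eventually_elim
    case (elim s)
    have s: "norm s = 1" "s \<noteq> 1"
      using elim space_circle[OF sets] by auto
    have "Re s \<noteq> 1"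
      using norm_circle_diff_1[OF s(1)] s(2) by auto
    then have Re: "Re s = Re a"
      using elim by (simp add: g_def)
    have "(Re s)\<^sup>2 + (Im s)\<^sup>2 = (Re a)\<^sup>2 + (Im a)\<^sup>2"
      using s(1) a(1) by (simp flip: cmod_power2)
    then have "Im s = Im a \<or> Im s = - Im a"
      by (simp add: Re power2_eq_iff)
    then show ?case
      using Re by (auto simp: complex_eq_iff)
  qed
  define c' where "c' = measure \<rho> {a}"
  \<comment> \<open>Removing \<open>a\<close> avoids counting the same point twice when
    \<open>a = cnj a\<close>, that is, when \<open>a = -1\<close>; then
    \<open>d' = 0\<close>.\<close>
  define d' where "d' = measure \<rho> ({cnj a} - {a})"
  have c': "emeasure \<rho> {a} = ennreal c'"
    using levy_measure_finite_point[OF \<rho>' a] unfolding c'_def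
    by (intro emeasure_eq_ennreal_measure) auto
  have d': "emeasure \<rho> ({cnj a} - {a}) = ennreal d'"
    using levy_measure_finite_point[OF \<rho>' a'] unfolding d'_def
    by (intro emeasure_eq_ennreal_measure) (cases "cnj a = a", auto)
  have nonneg: "0 \<le> c'" "0 \<le> d'"
    by (simp_all add: c'_def d'_def)
  have "\<rho> = two_point_measure c' a d' (cnj a)"
  proof (rule measure_eqI)
    fix A assume "A \<in> sets \<rho>"
    then have A: "A \<in> sets circle_borel"
      by (simp add: sets)
    have pts: "{a} \<in> sets circle_borel" "{cnj a} \<in> sets circle_borel"
      using a a' by (simp_all add: sets_circle_borel_iff)
    have meas: "A \<inter> {a} \<in> sets \<rho>" "A \<inter> ({cnj a} - {a}) \<in> sets \<rho>"
      using A pts by (auto simp: sets)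
    have "emeasure \<rho> A = emeasure \<rho> (A \<inter> {a} \<union> A \<inter> ({cnj a} - {a}))"
      using supp A meas by (intro emeasure_eq_AE) (auto simp: sets)
    also have "\<dots> = emeasure \<rho> (A \<inter> {a}) + emeasure \<rho> (A \<inter> ({cnj a} - {a}))"
      by (intro plus_emeasure[symmetric] meas) auto
    also have "emeasure \<rho> (A \<inter> {a}) = ennreal c' * indicator A a"
      using c' by (cases "a \<in> A") auto
    also have "emeasure \<rho> (A \<inter> ({cnj a} - {a})) = ennreal d' * indicator A (cnj a)"
    proof (cases "cnj a \<in> A")
      case True
      then have "A \<inter> ({cnj a} - {a}) = {cnj a} - {a}" by auto
      then show ?thesis using True d' by simp
    next
      case False
      then have "A \<inter> ({cnj a} - {a}) = {}" by auto
      then show ?thesis using False by simp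
    qed
    finally show "emeasure \<rho> A = emeasure (two_point_measure c' a d' (cnj a)) A"
      using A nonneg a a' by (simp add: emeasure_two_point_measure)
  qed (simp add: sets)
  then show ?thesis
    using that nonneg by blast
qed

section \<open>The arithmetic of the imaginary parts\<close>

text \<open>\<open>chebyshev_num p q n = q\<^sup>n U\<^sub>n(p / (2 q))\<close> for the Chebyshev polynomials \<open>U\<^sub>n\<close> of the second kind.\<close>

fun chebyshev_num :: "int \<Rightarrow> int \<Rightarrow> nat \<Rightarrow> int" where
  "chebyshev_num p q 0 = 1"
| "chebyshev_num p q (Suc 0) = p"
| "chebyshev_num p q (Suc (Suc n)) = p * chebyshev_num p q (Suc n) - q\<^sup>2 * chebyshev_num p q n"

text \<open>Modulo \<open>q\<close> the recurrence is multiplication by \<open>p\<close>, so the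
  \<open>n\<close>-th term is congruent to \<open>p ^ n\<close>.\<close>

lemma coprime_chebyshev_num:
  assumes "coprime p q"
  shows "coprime (chebyshev_num p q n) q"
  using assms
proof (induction p q n rule: chebyshev_num.induct)
  case (3 p q n)
  have "coprime (p * chebyshev_num p q (Suc n)) q"
    using 3 by simp
  moreover have "chebyshev_num p q (Suc (Suc n)) = p * chebyshev_num p q (Suc n) + q * (- q * chebyshev_num p q n)"
    by (simp add: power2_eq_square)
  ultimately show ?case
    using gcd_add_mult[of q "- q * chebyshev_num p q n" "p * chebyshev_num p q (Suc n)"]
    by (simp add: coprime_iff_gcd_eq_1 gcd.commute power2_eq_square algebra_simps)
qed auto

text \<open>The identity \<open>U\<^sub>n(cos t) sin t = sin ((n + 1) t)\<close>, cleared of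
  denominators; the recurrence is the addition formula for
  \<open>sin ((n + 3) t) + sin ((n + 1) t)\<close>.\<close>

lemma sin_chebyshev_num:
  assumes "2 * cos t * real_of_int q = real_of_int p"
  shows "of_int (chebyshev_num p q n) * sin t = of_int (q ^ n) * sin (real (Suc n) * t)"
  using assms
proof (induction p q n rule: chebyshev_num.induct)
  case (2 p q)
  then show ?case
    by (simp add: sin_double flip: 2)
next
  case (3 p q n)
  have "sin (real (Suc (Suc (Suc n))) * t) + sin (real (Suc n) * t) = 2 * cos t * sin (real (Suc (Suc n)) * t)"
    by (simp add: sin_plus_sin algebra_simps add_divide_distrib)
  then have rec: "sin (real (Suc (Suc (Suc n))) * t) = 2 * cos t * sin (real (Suc (Suc n)) * t) - sin (real (Suc n) * t)"
    by linarith
  have "of_int (chebyshev_num p q (Suc (Suc n))) * sin t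
      = of_int p * (of_int (chebyshev_num p q (Suc n)) * sin t) - of_int (q\<^sup>2) * (of_int (chebyshev_num p q n) * sin t)"
    by (simp add: algebra_simps)
  also have "\<dots> = (2 * cos t * of_int q) * (of_int (q ^ Suc n) * sin (real (Suc (Suc n)) * t))
      - of_int (q\<^sup>2) * (of_int (q ^ n) * sin (real (Suc n) * t))"
    using 3 by simp
  also have "\<dots> = of_int (q ^ Suc (Suc n)) * sin (real (Suc (Suc (Suc n))) * t)"
    unfolding rec by (simp add: power2_eq_square algebra_simps)
  finally show ?case .
qed auto

lemma power_dvd_all_imp_unit:
  fixes q r :: int
  assumes "r \<noteq> 0" "0 < q" "\<And>n. q ^ n dvd r"
  shows "q = 1"
proof (rule ccontr)
  assume "q \<noteq> 1"
  then have q: "2 \<le> q" using assms by simp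
  have "int n < q ^ n" for n
  proof -
    have "int n < 2 ^ n"
      using less_exp[of n] by (metis of_nat_less_iff of_nat_numeral of_nat_power)
    also have "\<dots> \<le> q ^ n"
      using q by (intro power_mono) auto
    finally show ?thesis .
  qed
  from this[of "nat \<bar>r\<bar>"] have "\<bar>r\<bar> < q ^ nat \<bar>r\<bar>"
    by simp
  moreover have "q ^ nat \<bar>r\<bar> \<le> \<bar>r\<bar>"
    using assms by (intro zdvd_imp_le) auto
  ultimately show False by simp
qed

text \<open>The conditions for \<open>n = 2, 3\<close> make \<open>2 cos t\<close> rational, say \<open>p / q\<close>. Since
  \<open>w sin (n t)\<close> then has bounded denominators while \<open>q\<^sup>n U\<^sub>n(cos t)\<close> is coprime to \<open>q\<close>,
  \<open>q\<close> must be \<open>1\<close>.\<close>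

lemma double_cos_in_Ints:
  fixes w t :: real
  assumes w: "w \<noteq> 0" and t: "sin t \<noteq> 0"
    and int: "\<And>n::nat. w * (sin (n * t) - n * sin t) \<in> \<int>"
  shows "2 * cos t \<in> \<int>"
proof -
  define u where "u = w * sin t"
  define x where "x = cos t"
  have u: "u \<noteq> 0"
    using w t by (simp add: u_def)
  have x: "x \<noteq> 1"
  proof
    assume "x = 1"
    then show False
      using t sin_cos_squared_add[of t] by (simp add: x_def)
  qed
  have sin3: "sin (3 * t) = sin t * (4 * x\<^sup>2 - 1)"
  proof -
    have "sin (3 * t) = sin (2 * t + t)" by simp
    also have "\<dots> = sin t * (2 * x\<^sup>2 + cos (2 * t))"
      unfolding sin_add sin_double x_def by (simp add: power2_eq_square algebra_simps)
    finally show ?thesis by (simp add: cos_double_cos x_def)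
  qed
  have "2 * u * (x - 1) = w * (sin (real 2 * t) - real 2 * sin t)"
    unfolding of_nat_numeral sin_double by (simp add: u_def x_def algebra_simps)
  then have Z2: "2 * u * (x - 1) \<in> \<int>"
    using int[of 2] by simp
  have "4 * u * (x\<^sup>2 - 1) = w * (sin (real 3 * t) - real 3 * sin t)"
    unfolding of_nat_numeral sin3 by (simp add: u_def algebra_simps)
  then have Z3: "4 * u * (x\<^sup>2 - 1) \<in> \<int>"
    using int[of 3] by simp
  \<comment> \<open>The quotient of the conditions for \<open>n = 3\<close> and \<open>n = 2\<close>
    is \<open>2 (x + 1)\<close>.\<close>
  have "2 * x = (4 * u * (x\<^sup>2 - 1)) / (2 * u * (x - 1)) - 2"
    using u x by (simp add: field_simps power2_eq_square)
  then have rat: "2 * x \<in> \<rat>"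
    using Z2 Z3 Ints_subset_Rats by (metis Rats_diff Rats_divide Rats_number_of subsetD)
  then obtain p q :: int where q: "0 < q" "coprime p q" and pq: "2 * x = of_int p / of_int q"
    by (elim Rats_cases') auto
  have "u = (2 * u * (x - 1)) / (2 * x - 2)"
    using x by (simp add: field_simps)
  then have "u \<in> \<rat>"
    using Z2 rat Ints_subset_Rats by (metis Rats_diff Rats_divide Rats_number_of subsetD)
  then obtain r m :: int where m: "0 < m" and rm: "u = of_int r / of_int m"
    by (elim Rats_cases') auto
  have "r \<noteq> 0"
    using u rm by auto
  moreover have "q ^ n dvd r" for n
  proof -
    obtain k :: int where k: "w * (sin (real (Suc n) * t) - real (Suc n) * sin t) = of_int k"
      using int[of "Suc n"] by (auto elim: Ints_cases)
    \<comment> \<open>The integer \<open>l\<close> is \<open>m w sin ((n + 1) t)\<close>: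
      multiplying by the fixed denominator \<open>m\<close> of \<open>u\<close> makes the linear
      term \<open>(n + 1) u\<close> integral as well.\<close>
    define l where "l = m * k + r * int (Suc n)"
    have mu: "of_int m * u = of_int r"
      using m rm by simp
    have "of_int l = of_int m * (w * (sin (real (Suc n) * t) - real (Suc n) * sin t)) + of_int m * u * real (Suc n)"
      unfolding k mu l_def by simp
    also have "\<dots> = of_int m * w * sin (real (Suc n) * t)"
      by (simp add: u_def algebra_simps)
    finally have l: "of_int l = of_int m * w * sin (real (Suc n) * t)" .
    have "of_int (chebyshev_num p q n) * sin t = of_int (q ^ n) * sin (real (Suc n) * t)"
      using q pq by (intro sin_chebyshev_num) (simp add: x_def field_simps)
    then have "of_int m * w * (of_int (chebyshev_num p q n) * sin t) = of_int (q ^ n) * real_of_int l"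
      by (simp add: l)
    moreover have "of_int m * w * (of_int (chebyshev_num p q n) * sin t) = of_int (chebyshev_num p q n) * (of_int m * u)"
      by (simp add: u_def)
    ultimately have "real_of_int (chebyshev_num p q n * r) = real_of_int (q ^ n * l)"
      by (simp add: mu)
    then have "chebyshev_num p q n * r = q ^ n * l"
      by (simp only: of_int_eq_iff)
    then have "q ^ n dvd chebyshev_num p q n * r"
      by simp
    moreover have "coprime (q ^ n) (chebyshev_num p q n)"
      using coprime_chebyshev_num[OF q(2), of n] by (simp add: coprime_commute)
    ultimately show ?thesis
      by (simp add: coprime_dvd_mult_right_iff)
  qed
  ultimately have "q = 1"
    using q power_dvd_all_imp_unit by blast
  then show ?thesis
    using pq by (simp add: x_def)
qed

theorem theorem8p5:
  fixes \<phi> c d :: real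
  assumes "0 < \<phi>" and "\<phi> \<le> pi" and "c \<ge> 0" and "d \<ge> 0"
    and "cos \<phi> = -1 \<or> cos \<phi> \<notin> dyadic_rationals"
  shows "L_unique (two_point_measure c (exp (\<i> * of_real \<phi>)) d (cnj (exp (\<i> * of_real \<phi>))))"
proof -
  define a where "a = cis \<phi>"
  let ?T = "two_point_measure c a d (cnj a)"
  have cos: "cos \<phi> \<noteq> 1"
    using assms cos_monotone_0_pi[of 0 \<phi>] by simp
  have a: "norm a = 1" "a \<noteq> 1" "norm (cnj a) = 1" "cnj a \<noteq> 1"
    using cos by (auto simp: a_def complex_eq_iff)
  have T: "levy_measure ?T"
    by (intro levy_measure_two_point assms a)
  \<comment> \<open>The real part sees only the sum of the weights and the imaginary part only their
    difference.\<close>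
  have exponent: "levy_exponent (two_point_measure c1 a d1 (cnj a)) n
      = Complex ((c1 + d1) * (cos (n * \<phi>) - 1)) ((c1 - d1) * (sin (n * \<phi>) - n * sin \<phi>))"
    if "0 \<le> c1" "0 \<le> d1" for c1 d1 n
  proof -
    have kernel: "levy_kernel n (cnj a) = cnj (levy_kernel n a)"
      using levy_kernel_cis[of n "- \<phi>"] by (simp add: a_def cis_cnj levy_kernel_cis complex_eq_iff)
    show ?thesis
      unfolding levy_exponent_two_point[OF that a(1,3)] kernel
      unfolding a_def levy_kernel_cis by (simp add: complex_eq_iff algebra_simps)
  qed
  have "\<rho> = ?T" if \<rho>: "\<rho> \<in> levy_class ?T" for \<rho>
  proof -
    obtain c' d' where cd': "0 \<le> c'" "0 \<le> d'" and \<rho>_eq: "\<rho> = two_point_measure c' a d' (cnj a)"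
      using levy_class_two_point[OF assms(3,4) a(1,2) \<rho>] by blast
    have "(c' + d') * (cos \<phi> - 1) = (c + d) * (cos \<phi> - 1)"
      using Re_levy_exponent_levy_class[OF T \<rho>, of 1] exponent[OF cd', of 1] exponent[OF assms(3,4), of 1]
      by (simp add: \<rho>_eq)
    then have sum: "c' + d' = c + d"
      using cos by simp
    have int: "(c' - c) / pi * (sin (n * \<phi>) - n * sin \<phi>) \<in> \<int>" for n :: nat
    proof -
      let ?S = "sin (n * \<phi>) - n * sin \<phi>"
      obtain k :: int where
        "levy_exponent \<rho> (int n) = levy_exponent ?T (int n) + of_int (2 * k) * pi * \<i>"
        using levy_class_exponent[OF T \<rho>, of "int n"] unfolding exp_eq by blast
      then have "Im (levy_exponent \<rho> (int n)) = Im (levy_exponent ?T (int n)) + 2 * k * pi"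
        by simp
      then have "(c' - d') * ?S = (c - d) * ?S + 2 * k * pi"
        by (simp add: \<rho>_eq exponent[OF cd'] exponent[OF assms(3,4)])
      \<comment> \<open>At equal sums the difference of weights moves by twice the change of
        \<open>c\<close>; this \<open>2\<close> cancels against the one in
        \<open>2 k \<pi>\<close>.\<close>
      moreover have "c' - d' = c - d + 2 * (c' - c)"
        using sum by simp
      ultimately have "(c' - c) * ?S = k * pi"
        by (simp add: algebra_simps)
      then have "(c' - c) / pi * ?S = k"
        by (simp add: field_simps)
      then show ?thesis
        by (metis Ints_of_int)
    qed
    show ?thesis
    proof (cases "sin \<phi> = 0")
      case True
      then have "\<phi> = pi"
        using assms(1,2) sin_gt_zero[of \<phi>] by force
      \<comment> \<open>Here \<open>a = -1\<close>: both masses sit at one point, and only their sum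
        enters the measure.\<close>
      then have real: "cnj a = a"
        by (simp add: a_def complex_eq_iff)
      show ?thesis
      proof (rule measure_eqI)
        fix A assume "A \<in> sets \<rho>"
        then have "A \<in> sets circle_borel"
          by (simp add: \<rho>_eq)
        then show "emeasure \<rho> A = emeasure ?T A"
          using sum a cd' assms(3,4)
          by (simp add: \<rho>_eq real emeasure_two_point_measure flip: distrib_right ennreal_plus)
      qed (simp add: \<rho>_eq)
    next
      case False
      have "c' = c"
      proof (rule ccontr)
        assume "c' \<noteq> c"
        then have "2 * cos \<phi> \<in> \<int>"
          using False int by (intro double_cos_in_Ints[of "(c' - c) / pi"]) auto
        then obtain k :: int where "2 * cos \<phi> = of_int k"
          by (elim Ints_cases)
        then have "cos \<phi> = of_int k / 2 ^ nat 1"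
          by simp
        then have "cos \<phi> \<in> dyadic_rationals"
          unfolding dyadic_rationals_def by (intro CollectI exI[of _ k] exI[of _ "1::int"]) simp
        \<comment> \<open>A dyadic cosine leaves only this alternative of the assumption, and it
          contradicts \<open>sin \<phi> \<noteq> 0\<close>.\<close>
        then have "cos \<phi> = -1"
          using assms(5) by simp
        then show False
          using False sin_cos_squared_add[of \<phi>] by simp
      qed
      then show ?thesis
        using sum by (simp add: \<rho>_eq)
    qed
  qed
  moreover have "?T \<in> levy_class ?T"
    using T by (simp add: levy_class_def)
  ultimately have "L_unique ?T"
    unfolding L_unique_def by blast
  then show ?thesis
    by (simp add: a_def cis_conv_exp)
qed

end
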